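(* Let $n\ge 1$, let $\tau$ be an integer, and let $\alpha\in[0,1)$. Let $G$ be a graph having the maximum $A_\alpha$-index among all connected graphs of order $n$ with dissociation number $\tau$. Then $G\cong K_{n-\tau}\vee\left(\frac{\tau}{2}K_2\right)$ if $\tau$ is even, and $G\cong K_{n-\tau}\vee\left(\frac{\tau-1}{2}K_2\cup K_1\right)$ if $\tau$ is odd.
   Context: All graphs are simple and finite. For a graph $G$ with adjacency matrix $A(G)$ and diagonal degree matrix $D(G)$, and $\alpha\in[0,1]$, let $A_\alpha(G)=\alpha D(G)+(1-\alpha)A(G)$; its largest eigenvalue $\lambda_\alpha(G)$ is the $A_\alpha$-index of $G$. A set $S\subseteq V(G)$ is a dissociation set if the induced subgraph $G[S]$ has maximum degree at most $1$; the dissociation number $\tau(G)$ is the maximum cardinality of a dissociation set. $G\vee H$ denotes the join (disjoint union plus all edges between $G$ and $H$), $G\cup H$ the disjoint union, and $kG$ the disjoint union of $k$ copies of $G$. *)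

theory Defs
  imports "Graph_Theory.Graph_Theory" "Jordan_Normal_Form.Spectral_Radius"
begin

text \<open>
  A finite simple graph is a symmetric loop-free finite digraph without parallel arcs, that is,
  some \<open>G\<close> with \<open>pair_graph G\<close>; an undirected edge is a pair of opposite arcs, and the
  degree of a vertex is its out-degree. Isomorphism is \<open>digraph_iso\<close>.
\<close>

section \<open>The \<open>A\<^sub>\<alpha>\<close>-index\<close>

text \<open>
  Matrices are indexed by natural numbers, so the rows and columns of the matrices of a graph are
  attached to its vertices through an enumeration \<open>vs\<close> of the vertex set. The spectrum does
  not depend on it: see \<open>spectrum_A_alpha_mat_enumeration\<close> below.
\<close>

definition adjacency_mat :: "'a list \<Rightarrow> 'a pair_pre_digraph \<Rightarrow> real mat" where
  "adjacency_mat vs G =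
     mat (length vs) (length vs) (\<lambda>(i, j). if (vs ! i, vs ! j) \<in> parcs G then 1 else 0)"

definition degree_mat :: "'a list \<Rightarrow> 'a pair_pre_digraph \<Rightarrow> real mat" where
  "degree_mat vs G =
     mat (length vs) (length vs)
       (\<lambda>(i, j). if i = j then real (out_degree (with_proj G) (vs ! i)) else 0)"

definition A_alpha_mat :: "real \<Rightarrow> 'a list \<Rightarrow> 'a pair_pre_digraph \<Rightarrow> real mat" where
  "A_alpha_mat \<alpha> vs G = \<alpha> \<cdot>\<^sub>m degree_mat vs G + (1 - \<alpha>) \<cdot>\<^sub>m adjacency_mat vs G"

definition vertex_list :: "'a pair_pre_digraph \<Rightarrow> 'a list" where
  "vertex_list G = (SOME vs. distinct vs \<and> set vs = pverts G)"

text \<open>The matrix is real symmetric, so the maximum over its real spectrum is its largest eigenvalue.\<close>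

definition A_alpha_index :: "real \<Rightarrow> 'a pair_pre_digraph \<Rightarrow> real" where
  "A_alpha_index \<alpha> G = Max (spectrum (A_alpha_mat \<alpha> (vertex_list G) G))"

lemma vertex_list:
  assumes "finite (pverts G)"
  shows "distinct (vertex_list G)" "set (vertex_list G) = pverts G"
proof -
  have "\<exists>vs. distinct vs \<and> set vs = pverts G"
    using finite_distinct_list[OF assms] by blast
  then have "distinct (vertex_list G) \<and> set (vertex_list G) = pverts G"
    unfolding vertex_list_def by (rule someI_ex)
  then show "distinct (vertex_list G)" "set (vertex_list G) = pverts G" by auto
qed

lemma A_alpha_mat_mult_vec:
  assumes "distinct vs" and i: "i < length vs"
  shows "(A_alpha_mat \<alpha> vs G *\<^sub>v vec (length vs) (\<lambda>i. x (vs ! i))) $ i =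
    \<alpha> * real (out_degree (with_proj G) (vs ! i)) * x (vs ! i) +
    (1 - \<alpha>) * (\<Sum>w\<in>set vs. if (vs ! i, w) \<in> parcs G then x w else 0)"
proof -
  let ?n = "length vs" and ?d = "real (out_degree (with_proj G) (vs ! i))"
  let ?a = "\<lambda>w. if (vs ! i, w) \<in> parcs G then x w else 0"
  have bij: "bij_betw ((!) vs) {0..<?n} (set vs)"
    using bij_betw_nth[OF \<open>distinct vs\<close>, of "{0..<?n}" "set vs"] by (simp add: atLeast0LessThan)
  have "(A_alpha_mat \<alpha> vs G *\<^sub>v vec ?n (\<lambda>i. x (vs ! i))) $ i =
    (\<Sum>j = 0..<?n. (\<alpha> * (if i = j then ?d else 0) +
       (1 - \<alpha>) * (if (vs ! i, vs ! j) \<in> parcs G then 1 else 0)) * x (vs ! j))"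
    using i by (auto simp: A_alpha_mat_def degree_mat_def adjacency_mat_def scalar_prod_def
        intro!: sum.cong)
  also have "\<dots> = (\<Sum>j = 0..<?n. (if i = j then \<alpha> * ?d * x (vs ! i) else 0) +
       (1 - \<alpha>) * ?a (vs ! j))"
    by (auto simp: algebra_simps intro!: sum.cong)
  also have "\<dots> = \<alpha> * ?d * x (vs ! i) + (1 - \<alpha>) * (\<Sum>j = 0..<?n. ?a (vs ! j))"
    using i by (simp add: sum.distrib sum_distrib_left)
  also have "(\<Sum>j = 0..<?n. ?a (vs ! j)) = (\<Sum>w\<in>set vs. ?a w)"
    by (rule sum.reindex_bij_betw[OF bij])
  finally show ?thesis .
qed

lemma eigenvalue_A_alpha_mat_iff:
  assumes "distinct vs"
  shows "eigenvalue (A_alpha_mat \<alpha> vs G) k \<longleftrightarrow>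
    (\<exists>x. (\<exists>u\<in>set vs. x u \<noteq> 0) \<and>
      (\<forall>u\<in>set vs. \<alpha> * real (out_degree (with_proj G) u) * x u +
        (1 - \<alpha>) * (\<Sum>w\<in>set vs. if (u, w) \<in> parcs G then x w else 0) = k * x u))"
    (is "?L \<longleftrightarrow> (\<exists>x. ?nz x \<and> ?ev x)")
proof -
  let ?n = "length vs" and ?A = "A_alpha_mat \<alpha> vs G"
  let ?v = "\<lambda>x. vec ?n (\<lambda>i. x (vs ! i)) :: real vec"
  have dim: "dim_row ?A = ?n" by (simp add: A_alpha_mat_def adjacency_mat_def)
  have *: "eigenvector ?A (?v x) k \<longleftrightarrow> ?nz x \<and> ?ev x" for x
  proof -
    have "?v x \<noteq> 0\<^sub>v ?n \<longleftrightarrow> ?nz x"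
      unfolding set_conv_nth by (auto simp: vec_eq_iff)
    moreover have "?A *\<^sub>v ?v x = k \<cdot>\<^sub>v ?v x \<longleftrightarrow> (\<forall>i<?n. (?A *\<^sub>v ?v x) $ i = k * x (vs ! i))"
      unfolding vec_eq_iff by (simp add: dim)
    then have "?A *\<^sub>v ?v x = k \<cdot>\<^sub>v ?v x \<longleftrightarrow> ?ev x"
      using A_alpha_mat_mult_vec[OF assms, of _ \<alpha> G x] by (simp add: all_set_conv_all_nth)
    ultimately show ?thesis by (simp add: eigenvector_def dim)
  qed
  show ?thesis
  proof
    assume ?L
    then obtain v where v: "eigenvector ?A v k" by (auto simp: eigenvalue_def)
    define x where "x = (\<lambda>u. v $ (THE i. i < ?n \<and> vs ! i = u))"
    have "x (vs ! i) = v $ i" if "i < ?n" for i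
    proof -
      have "(THE j. j < ?n \<and> vs ! j = vs ! i) = i"
        using that assms by (auto simp: nth_eq_iff_index_eq)
      then show ?thesis by (simp add: x_def)
    qed
    moreover have "dim_vec v = ?n"
      using v unfolding eigenvector_def dim by (blast dest: carrier_vecD)
    ultimately have "?v x = v" by (intro eq_vecI) simp_all
    with v have "eigenvector ?A (?v x) k" by simp
    then show "\<exists>x. ?nz x \<and> ?ev x" unfolding * by (rule exI[of _ x])
  next
    assume "\<exists>x. ?nz x \<and> ?ev x"
    then obtain x where "?nz x \<and> ?ev x" ..
    then have "eigenvector ?A (?v x) k" unfolding * .
    then show ?L unfolding eigenvalue_def by (rule exI)
  qed
qed

lemma spectrum_A_alpha_mat_enumeration:
  assumes "distinct vs" "distinct ws" "set vs = set ws"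
  shows "spectrum (A_alpha_mat \<alpha> vs G) = spectrum (A_alpha_mat \<alpha> ws G)"
  unfolding spectrum_def eigenvalue_A_alpha_mat_iff[OF assms(1)]
    eigenvalue_A_alpha_mat_iff[OF assms(2)] assms(3) ..


section \<open>Dissociation number\<close>

definition dissociation_set :: "'a pair_pre_digraph \<Rightarrow> 'a set \<Rightarrow> bool" where
  "dissociation_set G S \<longleftrightarrow>
     S \<subseteq> pverts G \<and> (\<forall>v\<in>S. out_degree (with_proj G \<restriction> S) v \<le> 1)"

definition dissociation_number :: "'a pair_pre_digraph \<Rightarrow> nat" where
  "dissociation_number G = Max (card ` {S. dissociation_set G S})"

text \<open>
  All graphs here have vertices in a common type \<open>'a\<close>. If it has an \<open>n\<close>-element subset
  at all, every isomorphism class of graphs of order \<open>n\<close> is represented.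
\<close>

definition connected_graphs :: "nat \<Rightarrow> nat \<Rightarrow> 'a pair_pre_digraph set" where
  "connected_graphs n \<tau> = {G. pair_graph G \<and> Digraph_Component.connected (with_proj G) \<and>
     card (pverts G) = n \<and> dissociation_number G = \<tau>}"


section \<open>Constructions\<close>

definition complete_graph :: "nat \<Rightarrow> nat pair_pre_digraph" where
  "complete_graph n = \<lparr>pverts = {..<n}, parcs = {(i, j). i < n \<and> j < n \<and> i \<noteq> j}\<rparr>"

definition disjoint_union ::
  "'a pair_pre_digraph \<Rightarrow> 'b pair_pre_digraph \<Rightarrow> ('a + 'b) pair_pre_digraph" where
  "disjoint_union G H = \<lparr>pverts = pverts G <+> pverts H,
     parcs = {(Inl u, Inl v) |u v. (u, v) \<in> parcs G} \<union> {(Inr u, Inr v) |u v. (u, v) \<in> parcs H}\<rparr>"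

definition graph_join ::
  "'a pair_pre_digraph \<Rightarrow> 'b pair_pre_digraph \<Rightarrow> ('a + 'b) pair_pre_digraph" where
  "graph_join G H = \<lparr>pverts = pverts (disjoint_union G H),
     parcs = parcs (disjoint_union G H) \<union>
       {(Inl u, Inr v) |u v. u \<in> pverts G \<and> v \<in> pverts H} \<union>
       {(Inr v, Inl u) |u v. u \<in> pverts G \<and> v \<in> pverts H}\<rparr>"

definition copies :: "nat \<Rightarrow> 'a pair_pre_digraph \<Rightarrow> (nat \<times> 'a) pair_pre_digraph" where
  "copies k G = \<lparr>pverts = {..<k} \<times> pverts G,
     parcs = {((i, u), (i, v)) |i u v. i < k \<and> (u, v) \<in> parcs G}\<rparr>"

lemma complete_digraph_complete_graph: "complete_digraph n (with_proj (complete_graph n))"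
  unfolding complete_digraph_pair_def by (auto simp: complete_graph_def)

end

theory Submission
  imports Defs "HOL-Analysis.Function_Topology"
begin

text \<open>
  Let \<open>S\<close> be a maximum dissociation set of \<open>G\<close>. Add to \<open>G\<close> every edge not inside \<open>S\<close>, and
  extend the matching induced on \<open>S\<close> to one that misses at most one vertex. The result \<open>H\<close> is
  connected and contains \<open>G\<close>, so its dissociation number cannot grow, and it cannot shrink because
  \<open>S\<close> is still a dissociation set. If \<open>G \<noteq> H\<close>, the positive Perron vector of the connected
  graph \<open>G\<close>, used as a test vector in the Rayleigh quotient of \<open>H\<close>, shows that \<open>H\<close> has the
  larger index; hence \<open>G = H\<close>, which is the required join.
\<close>

section \<open>Real quadratic forms on a finite set\<close>

text \<open>Vectors are functions on the whole type of which only the values on \<open>V\<close>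
  count. Entries indexed by vertices keep the analysis free of any enumeration of
  \<open>V\<close>.\<close>

definition bilinear_form :: "('a \<Rightarrow> 'a \<Rightarrow> real) \<Rightarrow> 'a set \<Rightarrow> ('a \<Rightarrow> real) \<Rightarrow> ('a \<Rightarrow> real) \<Rightarrow> real" where
  "bilinear_form a V x y = (\<Sum>u\<in>V. \<Sum>w\<in>V. a u w * x u * y w)"

definition sq_norm :: "'a set \<Rightarrow> ('a \<Rightarrow> real) \<Rightarrow> real" where
  "sq_norm V x = (\<Sum>u\<in>V. (x u)\<^sup>2)"

section \<open>Algebra of the norm and the form\<close>

lemma sq_norm_nonneg: "0 \<le> sq_norm V x"
  by (simp add: sq_norm_def sum_nonneg)

lemma sq_norm_eq_0_iff: "finite V \<Longrightarrow> sq_norm V x = 0 \<longleftrightarrow> (\<forall>u\<in>V. x u = 0)"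
  by (simp add: sq_norm_def sum_nonneg_eq_0_iff)

lemma sq_norm_pos_iff: "finite V \<Longrightarrow> 0 < sq_norm V x \<longleftrightarrow> (\<exists>u\<in>V. x u \<noteq> 0)"
  by (metis less_le sq_norm_nonneg sq_norm_eq_0_iff)

lemma bilinear_form_scale:
  assumes "\<And>u. u \<in> V \<Longrightarrow> z u = c * x u"
  shows "bilinear_form a V z z = c\<^sup>2 * bilinear_form a V x x"
  unfolding bilinear_form_def sum_distrib_left
  by (intro sum.cong refl) (simp add: assms power2_eq_square algebra_simps)

lemma bilinear_form_add:
  assumes "\<And>u w. u \<in> V \<Longrightarrow> w \<in> V \<Longrightarrow> a u w = a w u"
  shows "bilinear_form a V (\<lambda>u. x u + t * z u) (\<lambda>u. x u + t * z u) =
    bilinear_form a V x x + 2 * t * bilinear_form a V z x + t\<^sup>2 * bilinear_form a V z z"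
proof -
  have "bilinear_form a V x z = (\<Sum>u\<in>V. \<Sum>w\<in>V. a w u * x w * z u)"
    unfolding bilinear_form_def by (rule sum.swap)
  also have "\<dots> = bilinear_form a V z x"
    unfolding bilinear_form_def
    by (intro sum.cong refl) (use assms in \<open>simp add: algebra_simps\<close>)
  finally have sym: "bilinear_form a V x z = bilinear_form a V z x" .
  have "bilinear_form a V (\<lambda>u. x u + t * z u) (\<lambda>u. x u + t * z u) =
    bilinear_form a V x x + t * bilinear_form a V x z + t * bilinear_form a V z x
      + t\<^sup>2 * bilinear_form a V z z"
    unfolding bilinear_form_def sum_distrib_left sum.distrib[symmetric]
    by (intro sum.cong refl) (simp add: power2_eq_square algebra_simps)
  then show ?thesis by (simp add: sym)
qed

lemma sq_norm_add:
  "sq_norm V (\<lambda>u. x u + t * z u) = sq_norm V x + 2 * t * (\<Sum>u\<in>V. z u * x u) + t\<^sup>2 * sq_norm V z"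
  unfolding sq_norm_def sum_distrib_left sum.distrib[symmetric]
  by (intro sum.cong refl) (simp add: power2_eq_square algebra_simps)

lemma bilinear_form_eq_sum_mult:
  "bilinear_form a V z x = (\<Sum>u\<in>V. z u * (\<Sum>w\<in>V. a u w * x w))"
  unfolding bilinear_form_def sum_distrib_left by (intro sum.cong refl) (simp add: algebra_simps)

lemma bilinear_form_eigen:
  assumes "\<And>u. u \<in> V \<Longrightarrow> (\<Sum>w\<in>V. a u w * x w) = k * x u"
  shows "bilinear_form a V x x = k * sq_norm V x"
proof -
  have "bilinear_form a V x x = (\<Sum>u\<in>V. x u * (k * x u))"
    unfolding bilinear_form_eq_sum_mult by (intro sum.cong refl) (simp add: assms)
  then show ?thesis
    by (simp add: sq_norm_def sum_distrib_left power2_eq_square mult.left_commute)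
qed

text \<open>A continuous function attains its maximum on the compact unit sphere; since form and
  squared norm are both homogeneous of degree two, the bound found there extends to every
  vector.\<close>

lemma rayleigh_maximum:
  fixes a :: "'a \<Rightarrow> 'a \<Rightarrow> real"
  assumes fin: "finite V" and ne: "V \<noteq> {}"
  obtains k x where "sq_norm V x = 1" "bilinear_form a V x x = k"
    "\<And>y. bilinear_form a V y y \<le> k * sq_norm V y"
proof -
  \<comment> \<open>Functions are pinned to 0 outside \<open>V\<close>, so \<open>B\<close> is a
    product of compact sets and Tychonoff applies even when the type is infinite. The box on
    \<open>V\<close> loses nothing: unit norm forces every coordinate into it.\<close>
  define B :: "('a \<Rightarrow> real) set" where "B = PiE UNIV (\<lambda>u. if u \<in> V then {-1..1} else {0})"
  define K where "K = B \<inter> {x. sq_norm V x = 1}"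
  have "compactin euclidean B"
    unfolding B_def euclidean_product_topology[symmetric] compactin_PiE by simp
  then have "compact B" by simp
  moreover have "closed {x. sq_norm V x = 1}"
    unfolding sq_norm_def by (intro closed_Collect_eq continuous_intros continuous_on_product_coordinates)
  ultimately have K: "compact K" unfolding K_def by (rule compact_Int_closed)
  have coord: "z u \<in> {-1..1}" if "sq_norm V z = 1" "u \<in> V" for z u
  proof -
    have "(z u)\<^sup>2 \<le> sq_norm V z"
      unfolding sq_norm_def by (rule member_le_sum) (use that fin in auto)
    with that show ?thesis using abs_le_square_iff[of "z u" 1] by auto
  qed
  obtain v where v: "v \<in> V" using ne by blast
  have "sq_norm V (\<lambda>u. if u = v then 1 else 0) = 1"
    using v fin by (simp add: sq_norm_def if_distrib[of "\<lambda>c. c\<^sup>2"] cong: if_cong)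
  then have "(\<lambda>u. if u = v then 1 else 0) \<in> K" using v by (auto simp: K_def B_def)
  then have "K \<noteq> {}" by blast
  moreover have "continuous_on K (\<lambda>x. bilinear_form a V x x)"
    unfolding bilinear_form_def
    by (intro continuous_intros continuous_on_subset[OF continuous_on_product_coordinates]) auto
  ultimately obtain x where x: "x \<in> K" "\<And>y. y \<in> K \<Longrightarrow> bilinear_form a V y y \<le> bilinear_form a V x x"
    using continuous_attains_sup[OF K] by blast
  have "bilinear_form a V y y \<le> bilinear_form a V x x * sq_norm V y" for y
  proof (cases "sq_norm V y = 0")
    case True
    then have "\<forall>u\<in>V. y u = 0" using sq_norm_eq_0_iff[OF fin] by blast
    then show ?thesis using True by (simp add: bilinear_form_def)
  next
    case False
    then have pos: "0 < sq_norm V y" using sq_norm_nonneg[of V y] by linarith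
    \<comment> \<open>Besides normalising \<open>y\<close>, this cuts it off outside
      \<open>V\<close>, as membership in \<open>K\<close> demands; the form does not see the
      cut.\<close>
    define z where "z u = (if u \<in> V then 1 / sqrt (sq_norm V y) * y u else 0)" for u
    have "sq_norm V z = (1 / sqrt (sq_norm V y))\<^sup>2 * sq_norm V y"
      unfolding sq_norm_def[of V z] sq_norm_def[of V y] sum_distrib_left
      by (intro sum.cong refl) (simp add: z_def power_mult_distrib sq_norm_def power_divide)
    also have "\<dots> = 1" using pos by (simp add: power_divide)
    finally have nz: "sq_norm V z = 1" .
    have "z \<in> K" using nz coord[OF nz] by (auto simp: K_def B_def PiE_iff) (auto simp: z_def)
    then have "bilinear_form a V z z \<le> bilinear_form a V x x" by (rule x)
    moreover have "bilinear_form a V z z = (1 / sqrt (sq_norm V y))\<^sup>2 * bilinear_form a V y y"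
      by (rule bilinear_form_scale) (simp add: z_def)
    ultimately show ?thesis using pos by (simp add: power_divide field_simps)
  qed
  with x(1) show ?thesis by (intro that[of x]) (auto simp: K_def)
qed

text \<open>
  First-order condition: perturb \<open>x\<close> in the direction of the residual \<open>A x - k x\<close>.
\<close>

lemma rayleigh_maximizer_eigen:
  assumes fin: "finite V"
    and sym: "\<And>u w. u \<in> V \<Longrightarrow> w \<in> V \<Longrightarrow> a u w = a w u"
    and le: "\<And>y. bilinear_form a V y y \<le> k * sq_norm V y"
    and max: "k * sq_norm V x \<le> bilinear_form a V x x"
    and u: "u \<in> V"
  shows "(\<Sum>w\<in>V. a u w * x w) = k * x u"
proof -
  define z where "z u = (\<Sum>w\<in>V. a u w * x w) - k * x u" for u
  define C where "C = k * sq_norm V z - bilinear_form a V z z"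
  have Ax: "(\<Sum>w\<in>V. a u w * x w) = z u + k * x u" for u by (simp add: z_def)
  have z: "bilinear_form a V z x = k * (\<Sum>u\<in>V. z u * x u) + sq_norm V z"
    unfolding bilinear_form_eq_sum_mult Ax sq_norm_def sum_distrib_left sum.distrib[symmetric]
    by (intro sum.cong refl) (simp add: power2_eq_square algebra_simps)
  have exp: "bilinear_form a V (\<lambda>u. x u + t * z u) (\<lambda>u. x u + t * z u) =
    bilinear_form a V x x + 2 * t * bilinear_form a V z x + t\<^sup>2 * bilinear_form a V z z" for t
    by (rule bilinear_form_add) (rule sym)
  \<comment> \<open>Inserting \<open>x + t * z\<close> into \<open>le\<close>, the constant terms
    are absorbed by \<open>max\<close> and the inner products of \<open>z\<close> and
    \<open>x\<close> cancel. A linear term bounded by a quadratic one remains, for every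
    \<open>t\<close>.\<close>
  have bound: "2 * t * sq_norm V z \<le> t\<^sup>2 * C" for t
  proof -
    have "bilinear_form a V x x + 2 * t * bilinear_form a V z x + t\<^sup>2 * bilinear_form a V z z \<le>
      k * (sq_norm V x + 2 * t * (\<Sum>u\<in>V. z u * x u) + t\<^sup>2 * sq_norm V z)"
      using le[of "\<lambda>u. x u + t * z u"]
      unfolding exp sq_norm_add .
    then show ?thesis using max unfolding z C_def by (simp add: algebra_simps)
  qed
  have "sq_norm V z \<le> 0"
  proof (rule ccontr)
    assume "\<not> ?thesis"
    then have pos: "0 < sq_norm V z" by simp
    \<comment> \<open>With this \<open>t\<close>, \<open>t * C\<close> is at most
      \<open>sq_norm V z\<close>, whereas \<open>bound\<close> asks for at least twice that. The
      added 1 keeps the denominator positive.\<close>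
    define t where "t = sq_norm V z / (\<bar>C\<bar> + 1)"
    have t: "0 < t" using pos by (simp add: t_def add_nonneg_pos)
    have "2 * sq_norm V z * t \<le> (t * C) * t"
      using bound[of t] by (simp add: power2_eq_square algebra_simps)
    then have "2 * sq_norm V z \<le> t * C" using t by (simp add: mult.commute)
    also have "\<dots> \<le> t * (\<bar>C\<bar> + 1)" using t by (intro mult_left_mono) auto
    also have "\<dots> = sq_norm V z" by (simp add: t_def add_nonneg_pos)
    finally show False using pos by simp
  qed
  then have "sq_norm V z = 0" using sq_norm_nonneg[of V z] by linarith
  then show ?thesis using u fin by (simp add: sq_norm_eq_0_iff z_def)
qed


section \<open>Strict monotonicity of the index\<close>

lemma pair_graph_finite:
  assumes "pair_graph G"
  shows "finite (pverts G)" "finite (parcs G)"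
  using assms by (auto simp: pair_graph_def pair_digraph_def pair_fin_digraph_def
      pair_fin_digraph_axioms_def)

lemma pair_graph_arcD:
  assumes "pair_graph G" "(u, v) \<in> parcs G"
  shows "u \<in> pverts G" "v \<in> pverts G" "u \<noteq> v" "(v, u) \<in> parcs G"
proof -
  interpret pair_graph G by fact
  show "u \<in> pverts G" "v \<in> pverts G" "u \<noteq> v" "(v, u) \<in> parcs G"
    using assms(2) in_arcsD1 in_arcsD2 no_loops' pair_sym_arcs
    by (auto simp: symmetric_def dest: symD)
qed

lemma pair_graphI:
  assumes "finite (pverts G)"
    and "\<And>u v. (u, v) \<in> parcs G \<Longrightarrow> u \<in> pverts G \<and> v \<in> pverts G \<and> u \<noteq> v \<and> (v, u) \<in> parcs G"
  shows "pair_graph G"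
proof -
  have "parcs G \<subseteq> pverts G \<times> pverts G" using assms(2) by auto
  then have "finite (parcs G)" using assms(1) finite_subset by blast
  then show ?thesis using assms
    by unfold_locales (fastforce simp: symmetric_def intro: symI)+
qed

lemma out_degree_with_proj: "out_degree (with_proj G) u = card {w. (u, w) \<in> parcs G}"
proof -
  have "out_arcs (with_proj G) u = Pair u ` {w. (u, w) \<in> parcs G}"
    by (auto simp: out_arcs_def)
  then show ?thesis by (simp add: out_degree_def card_image inj_on_def)
qed

text \<open>The entries of \<open>A_alpha_mat\<close> indexed by vertices instead of list positions;
  \<open>A_alpha_entry_mult\<close> links them to \<open>eigenvalue_A_alpha_mat_iff\<close>.\<close>

definition A_alpha_entry :: "real \<Rightarrow> 'a pair_pre_digraph \<Rightarrow> 'a \<Rightarrow> 'a \<Rightarrow> real" where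
  "A_alpha_entry \<alpha> G u w =
     (if u = w then \<alpha> * real (out_degree (with_proj G) u) else 0)
     + (1 - \<alpha>) * (if (u, w) \<in> parcs G then 1 else 0)"

lemma A_alpha_entry_mult:
  assumes "finite V" "u \<in> V"
  shows "(\<Sum>w\<in>V. A_alpha_entry \<alpha> G u w * x w) =
    \<alpha> * real (out_degree (with_proj G) u) * x u
    + (1 - \<alpha>) * (\<Sum>w\<in>V. if (u, w) \<in> parcs G then x w else 0)"
proof -
  have "(\<Sum>w\<in>V. A_alpha_entry \<alpha> G u w * x w) =
    (\<Sum>w\<in>V. (if u = w then \<alpha> * real (out_degree (with_proj G) u) * x u else 0)
      + (1 - \<alpha>) * (if (u, w) \<in> parcs G then x w else 0))"
    by (intro sum.cong refl) (simp add: A_alpha_entry_def algebra_simps)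
  then show ?thesis using assms by (simp add: sum.distrib sum_distrib_left)
qed

text \<open>The degree of \<open>u\<close> counts its outgoing arcs, so the diagonal term splits
  into one square per arc. In this form the effect of adding arcs is just a sum over the new
  ones.\<close>

lemma A_alpha_form_eq_sum_arcs:
  assumes G: "pair_graph G"
  shows "bilinear_form (A_alpha_entry \<alpha> G) (pverts G) x x =
    (\<Sum>(u, w)\<in>parcs G. \<alpha> * (x u)\<^sup>2 + (1 - \<alpha>) * (x u * x w))"
proof -
  let ?N = "\<lambda>u. {w. (u, w) \<in> parcs G}"
  have N: "?N u \<subseteq> pverts G" for u using pair_graph_arcD[OF G] by blast
  then have fN: "finite (?N u)" for u using pair_graph_finite[OF G] finite_subset by blast
  have arcs: "parcs G = Sigma (pverts G) ?N" using pair_graph_arcD[OF G] by auto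
  have "x u * (\<Sum>w\<in>pverts G. A_alpha_entry \<alpha> G u w * x w) =
      (\<Sum>w\<in>?N u. \<alpha> * (x u)\<^sup>2 + (1 - \<alpha>) * (x u * x w))" if "u \<in> pverts G" for u
  proof -
    have "(\<Sum>w\<in>pverts G. if (u, w) \<in> parcs G then x w else 0) = (\<Sum>w\<in>?N u. x w)"
      using N pair_graph_finite[OF G] by (intro sum.mono_neutral_cong_right) auto
    moreover have "(\<Sum>w\<in>?N u. \<alpha> * (x u)\<^sup>2 + (1 - \<alpha>) * (x u * x w)) =
        real (card (?N u)) * (\<alpha> * (x u)\<^sup>2) + (1 - \<alpha>) * (x u * (\<Sum>w\<in>?N u. x w))"
      by (simp add: sum.distrib sum_distrib_left)
    ultimately show ?thesis
      unfolding A_alpha_entry_mult[OF pair_graph_finite(1)[OF G] that] out_degree_with_proj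
      by (simp add: power2_eq_square algebra_simps)
  qed
  then have "bilinear_form (A_alpha_entry \<alpha> G) (pverts G) x x =
      (\<Sum>u\<in>pverts G. \<Sum>w\<in>?N u. \<alpha> * (x u)\<^sup>2 + (1 - \<alpha>) * (x u * x w))"
    unfolding bilinear_form_eq_sum_mult by (intro sum.cong refl)
  also have "\<dots> = (\<Sum>(u, w)\<in>Sigma (pverts G) ?N. \<alpha> * (x u)\<^sup>2 + (1 - \<alpha>) * (x u * x w))"
    using fN pair_graph_finite[OF G] by (intro sum.Sigma) auto
  finally show ?thesis unfolding arcs[symmetric] .
qed

section \<open>Variational characterisation of the index\<close>

lemma A_alpha_entry_sym:
  assumes "pair_graph G"
  shows "A_alpha_entry \<alpha> G u w = A_alpha_entry \<alpha> G w u"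
  using pair_graph_arcD(4)[OF assms] by (auto simp: A_alpha_entry_def)

text \<open>The maximum of the Rayleigh quotient is an eigenvalue by the first-order condition, and
  any eigenvalue is the quotient at its own eigenvector, hence no larger. So it is the
  \<open>Max\<close> of the finite spectrum.\<close>

lemma A_alpha_index_rayleigh:
  fixes G :: "'a pair_pre_digraph"
  assumes G: "pair_graph G" and ne: "pverts G \<noteq> {}"
  obtains x where "sq_norm (pverts G) x = 1"
    "bilinear_form (A_alpha_entry \<alpha> G) (pverts G) x x = A_alpha_index \<alpha> G"
    "\<And>y. bilinear_form (A_alpha_entry \<alpha> G) (pverts G) y y \<le> A_alpha_index \<alpha> G * sq_norm (pverts G) y"
proof -
  let ?V = "pverts G" and ?a = "A_alpha_entry \<alpha> G" and ?M = "A_alpha_mat \<alpha> (vertex_list G) G"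
  note fin = pair_graph_finite(1)[OF G]
  obtain k x where x: "sq_norm ?V x = 1" "bilinear_form ?a ?V x x = k"
    and le: "\<And>y. bilinear_form ?a ?V y y \<le> k * sq_norm ?V y"
    using rayleigh_maximum[OF fin ne, of ?a] by metis
  have eig: "eigenvalue ?M \<mu> \<longleftrightarrow>
      (\<exists>x. (\<exists>u\<in>?V. x u \<noteq> 0) \<and> (\<forall>u\<in>?V. (\<Sum>w\<in>?V. ?a u w * x w) = \<mu> * x u))" for \<mu>
    unfolding eigenvalue_A_alpha_mat_iff[OF vertex_list(1)[OF fin]] vertex_list(2)[OF fin]
    by (simp add: A_alpha_entry_mult[OF fin])
  have "eigenvalue ?M k"
    unfolding eig
  proof (intro exI conjI ballI)
    show "\<exists>u\<in>?V. x u \<noteq> 0" using x(1) sq_norm_pos_iff[OF fin, of x] by simp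
    show "(\<Sum>w\<in>?V. ?a u w * x w) = k * x u" if "u \<in> ?V" for u
      by (rule rayleigh_maximizer_eigen[OF fin A_alpha_entry_sym[OF G] le _ that]) (simp add: x)
  qed
  moreover have "\<mu> \<le> k" if ev: "eigenvalue ?M \<mu>" for \<mu>
  proof -
    obtain y where y: "\<exists>u\<in>?V. y u \<noteq> 0" "\<And>u. u \<in> ?V \<Longrightarrow> (\<Sum>w\<in>?V. ?a u w * y w) = \<mu> * y u"
      using ev unfolding eig by blast
    have "\<mu> * sq_norm ?V y \<le> k * sq_norm ?V y"
      using le[of y] bilinear_form_eigen[OF y(2)] by simp
    then show ?thesis using y(1) sq_norm_pos_iff[OF fin, of y] by simp
  qed
  moreover have "finite (spectrum ?M)"
    by (rule card_finite_spectrum(1)[of _ "length (vertex_list G)"])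
      (simp add: A_alpha_mat_def adjacency_mat_def degree_mat_def)
  ultimately have "A_alpha_index \<alpha> G = k"
    unfolding A_alpha_index_def by (intro Max_eqI) (auto simp: spectrum_def)
  with x le show ?thesis by (intro that[of x]) auto
qed

text \<open>Induction along a path in the symmetric closure. It serves to spread a zero of the
  Perron vector over the whole graph.\<close>

lemma connected_closed_set:
  assumes conn: "Digraph_Component.connected (with_proj G)"
    and step: "\<And>u v. u \<in> Z \<Longrightarrow> (u, v) \<in> parcs G \<or> (v, u) \<in> parcs G \<Longrightarrow> v \<in> Z"
    and u: "u \<in> pverts G" "u \<in> Z"
  shows "pverts G \<subseteq> Z"
proof
  fix v assume "v \<in> pverts G"
  then have "(u, v) \<in> rtrancl_on (pverts G) ((parcs G)\<^sup>s)"
    using conn u by (auto simp: connected_conv)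
  then show "v \<in> Z"
    by (induction rule: rtrancl_on_induct) (use u step in \<open>auto simp: symcl_def\<close>)
qed

lemma A_alpha_index_strict_mono:
  fixes G H :: "'a pair_pre_digraph"
  assumes \<alpha>: "0 \<le> \<alpha>" "\<alpha> < 1"
    and G: "pair_graph G" and H: "pair_graph H"
    and conn: "Digraph_Component.connected (with_proj G)"
    and V: "pverts G = pverts H" and E: "parcs G \<subset> parcs H"
  shows "A_alpha_index \<alpha> G < A_alpha_index \<alpha> H"
proof -
  let ?V = "pverts G" and ?f = "\<lambda>x (u, w). \<alpha> * (x u)\<^sup>2 + (1 - \<alpha>) * (x u * x w)"
  let ?Q = "\<lambda>G x. bilinear_form (A_alpha_entry \<alpha> G) (pverts G) x x"
  note fin = pair_graph_finite(1)[OF G]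
  have ne: "?V \<noteq> {}" using conn by (simp add: connected_conv)
  obtain x where x: "sq_norm ?V x = 1" "?Q G x = A_alpha_index \<alpha> G"
    and le: "\<And>y. ?Q G y \<le> A_alpha_index \<alpha> G * sq_norm ?V y"
    using A_alpha_index_rayleigh[OF G ne] by metis
  \<comment> \<open>Taking absolute values keeps the norm and, as the weights \<alpha> and 1 -
    \<alpha> are nonnegative, does not decrease the form. So \<open>y\<close> is again a maximiser
    and therefore an eigenvector.\<close>
  define y where "y u = \<bar>x u\<bar>" for u
  have Ny: "sq_norm ?V y = 1" using x(1) by (simp add: sq_norm_def y_def)
  have "?Q G x \<le> ?Q G y"
    unfolding A_alpha_form_eq_sum_arcs[OF G]
  proof (rule sum_mono, clarify)
    fix u w
    have "x u * x w \<le> y u * y w" unfolding y_def by (metis abs_ge_self abs_mult)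
    then show "\<alpha> * (x u)\<^sup>2 + (1 - \<alpha>) * (x u * x w) \<le> \<alpha> * (y u)\<^sup>2 + (1 - \<alpha>) * (y u * y w)"
      using \<alpha> by (simp add: y_def mult_left_mono)
  qed
  then have Qy: "?Q G y = A_alpha_index \<alpha> G" using x le[of y] Ny by simp
  have eig: "(\<Sum>w\<in>?V. A_alpha_entry \<alpha> G u w * y w) = A_alpha_index \<alpha> G * y u" if "u \<in> ?V" for u
    by (rule rayleigh_maximizer_eigen[OF fin A_alpha_entry_sym[OF G] le _ that]) (simp add: Qy Ny)
  \<comment> \<open>At a zero of \<open>y\<close> the eigenvalue equation reduces to a vanishing sum
    over the neighbours, because 1 - \<alpha> is nonzero. Its terms are nonnegative, so each of them
    vanishes.\<close>
  have zero: "y v = 0" if "y u = 0" "(u, v) \<in> parcs G" for u v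
  proof -
    have u: "u \<in> ?V" and v: "v \<in> ?V" using pair_graph_arcD[OF G that(2)] by auto
    have "(\<Sum>w\<in>?V. if (u, w) \<in> parcs G then y w else 0) = 0"
      using eig[OF u] \<alpha> that(1) by (simp add: A_alpha_entry_mult[OF fin u])
    then have "(if (u, v) \<in> parcs G then y v else 0) = 0"
      using v fin by (subst (asm) sum_nonneg_eq_0_iff) (auto simp: y_def)
    then show ?thesis using that(2) by simp
  qed
  have pos: "0 < y u" if "u \<in> ?V" for u
  proof (rule ccontr)
    assume "\<not> ?thesis"
    then have "u \<in> {u. y u = 0}" by (simp add: y_def)
    then have "?V \<subseteq> {u. y u = 0}"
      by (intro connected_closed_set[OF conn _ that]) (use zero pair_graph_arcD(4)[OF G] in auto)
    then show False using Ny sq_norm_pos_iff[OF fin, of y] by auto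
  qed
  have "0 < (\<Sum>e\<in>parcs H - parcs G. ?f y e)"
  proof (rule sum_pos)
    show "finite (parcs H - parcs G)" using pair_graph_finite[OF H] by simp
    show "parcs H - parcs G \<noteq> {}" using E by blast
    show "0 < ?f y e" if "e \<in> parcs H - parcs G" for e
    proof -
      obtain u w where e: "e = (u, w)" by fastforce
      then have "0 < y u" "0 < y w" using that pos V pair_graph_arcD[OF H, of u w] by auto
      \<comment> \<open>Since \<alpha> may be 0, strict positivity comes from the mixed term with
        factor 1 - \<alpha>.\<close>
      then show ?thesis using \<alpha> by (simp add: e add_nonneg_pos)
    qed
  qed
  moreover have "?Q H y = (\<Sum>e\<in>parcs H - parcs G. ?f y e) + ?Q G y"
    unfolding A_alpha_form_eq_sum_arcs[OF G] A_alpha_form_eq_sum_arcs[OF H]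
    using E pair_graph_finite[OF H] by (intro sum.subset_diff) auto
  moreover have "?Q H y \<le> A_alpha_index \<alpha> H * sq_norm (pverts H) y"
    using A_alpha_index_rayleigh[OF H] ne V by metis
  ultimately show ?thesis using Qy Ny V by simp
qed

section \<open>Saturating a graph along a dissociation set\<close>

lemma finite_dissociation_sets:
  assumes "pair_graph G"
  shows "finite {S. dissociation_set G S}"
  using pair_graph_finite(1)[OF assms]
  by (rule finite_subset[rotated, OF finite_Pow_iff[THEN iffD2]]) (auto simp: dissociation_set_def)

lemma dissociation_number_attained:
  assumes "pair_graph G"
  obtains S where "dissociation_set G S" "card S = dissociation_number G"
proof -
  have "dissociation_set G {}" by (simp add: dissociation_set_def)
  then have "dissociation_number G \<in> card ` {S. dissociation_set G S}"
    unfolding dissociation_number_def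
    by (intro Max_in finite_imageI finite_dissociation_sets assms) auto
  then show ?thesis using that by auto
qed

lemma card_le_dissociation_number:
  assumes "pair_graph G" "dissociation_set G S"
  shows "card S \<le> dissociation_number G"
  unfolding dissociation_number_def
  by (rule Max_ge) (use assms finite_dissociation_sets in auto)

text \<open>Trades the degree bound for uniqueness of the neighbour inside \<open>S\<close>, a
  condition visibly preserved when arcs are removed.\<close>

lemma dissociation_set_iff:
  assumes G: "pair_graph G"
  shows "dissociation_set G S \<longleftrightarrow> S \<subseteq> pverts G \<and>
    (\<forall>u\<in>S. \<forall>v\<in>S. \<forall>w\<in>S. (u, v) \<in> parcs G \<and> (u, w) \<in> parcs G \<longrightarrow> v = w)"
proof -
  have "out_degree (with_proj G \<restriction> S) u \<le> 1 \<longleftrightarrow>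
      (\<forall>v\<in>S. \<forall>w\<in>S. (u, v) \<in> parcs G \<and> (u, w) \<in> parcs G \<longrightarrow> v = w)" if "u \<in> S" for u
  proof -
    have *: "out_arcs (with_proj G \<restriction> S) u = Pair u ` {v \<in> S. (u, v) \<in> parcs G}"
      using that by (auto simp: out_arcs_def)
    have "finite {v \<in> S. (u, v) \<in> parcs G}"
      by (rule finite_subset[OF _ pair_graph_finite(1)[OF G]]) (use pair_graph_arcD[OF G] in auto)
    then show ?thesis
      unfolding out_degree_def * by (subst card_image) (auto simp: inj_on_def card_le_Suc0_iff_eq)
  qed
  then show ?thesis by (auto simp: dissociation_set_def)
qed

text \<open>Induction removing one matched pair: it receives 0 and 1, and the other numbers move up
  by 2, which preserves blocks of equal halves. When no matched pair is left any numbering works,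
  and it pairs the unmatched vertices consecutively. This is how the matching gets extended until at
  most one vertex is missed.\<close>

lemma matching_enumeration:
  fixes R :: "'a \<Rightarrow> 'a \<Rightarrow> bool"
  assumes "finite S"
    and "\<And>u v. u \<in> S \<Longrightarrow> v \<in> S \<Longrightarrow> R u v \<Longrightarrow> u \<noteq> v \<and> R v u"
    and "\<And>u v w. u \<in> S \<Longrightarrow> v \<in> S \<Longrightarrow> w \<in> S \<Longrightarrow> R u v \<Longrightarrow> R u w \<Longrightarrow> v = w"
  shows "\<exists>f::'a \<Rightarrow> nat. bij_betw f S {..<card S} \<and>
    (\<forall>u\<in>S. \<forall>v\<in>S. R u v \<longrightarrow> f u div 2 = f v div 2)"
  using assms
proof (induction rule: finite_psubset_induct)
  case (psubset S)
  show ?case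
  proof (cases "\<exists>u\<in>S. \<exists>v\<in>S. R u v")
    case False
    obtain f where "bij_betw f S {..<card S}"
      using ex_bij_betw_finite_nat[OF psubset.hyps] by (auto simp: atLeast0LessThan)
    with False show ?thesis by blast
  next
    case True
    then obtain u v where uv: "u \<in> S" "v \<in> S" "R u v" by blast
    then have ne: "u \<noteq> v" "R v u" using psubset.prems(1) by auto
    define T where "T = S - {u, v}"
    have S: "S = insert u (insert v T)" "u \<notin> T" "v \<notin> T" using uv by (auto simp: T_def)
    have "T \<subset> S" using uv by (auto simp: T_def)
    then have "\<exists>f::'a \<Rightarrow> nat. bij_betw f T {..<card T} \<and>
        (\<forall>u\<in>T. \<forall>v\<in>T. R u v \<longrightarrow> f u div 2 = f v div 2)"
      by (rule psubset.IH) (use psubset.prems S(1) in \<open>meson insertCI\<close>)+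
    then obtain f :: "'a \<Rightarrow> nat" where f: "bij_betw f T {..<card T}"
      "\<And>x y. x \<in> T \<Longrightarrow> y \<in> T \<Longrightarrow> R x y \<Longrightarrow> f x div 2 = f y div 2" by blast
    define g where "g x = (if x = u then 0 else if x = v then 1 else f x + 2)" for x
    have gT: "g x = f x + 2" if "x \<in> T" for x using that S by (auto simp: g_def)
    have guv: "g u = 0" "g v = 1" using ne by (auto simp: g_def)
    have cS: "card S = Suc (Suc (card T))"
      using psubset.hyps S ne by (simp add: S(1))
    have "g ` S = {..<card S}"
    proof -
      have "g ` T = (\<lambda>i. i + 2) ` f ` T" using gT by (auto simp: image_image)
      also have "f ` T = {..<card T}" using f(1) by (rule bij_betw_imp_surj_on)
      finally have "g ` S = insert 0 (insert 1 ((\<lambda>i. i + 2) ` {..<card T}))"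
        by (simp add: S(1) guv)
      also have "\<dots> = {..<card S}"
        unfolding cS lessThan_Suc_eq_insert_0 by (simp add: image_image)
      finally show ?thesis .
    qed
    then have "bij_betw g S {..<card S}"
      by (simp add: bij_betw_def eq_card_imp_inj_on psubset.hyps)
    moreover have "g x div 2 = g y div 2" if xy: "x \<in> S" "y \<in> S" "R x y" for x y
    proof -
      have yx: "R y x" using psubset.prems(1) xy by blast
      \<comment> \<open>In a matching \<open>u\<close> and \<open>v\<close> have only each other as
        partners, so no related pair joins them to \<open>T\<close>.\<close>
      have "x \<in> T \<and> y \<in> T \<or> x = u \<and> y = v \<or> x = v \<and> y = u"
        using psubset.prems(2) xy yx uv ne S(1) by (metis insert_iff)
      then show ?thesis using f(2)[of x y] xy(3) gT guv by auto
    qed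
    ultimately show ?thesis by blast
  qed
qed

text \<open>
  The vertices of \<open>S\<close> numbered \<open>2 i\<close> and \<open>2 i + 1\<close> by \<open>f\<close> are matched.
\<close>

definition saturated_graph :: "'a set \<Rightarrow> 'a set \<Rightarrow> ('a \<Rightarrow> nat) \<Rightarrow> 'a pair_pre_digraph" where
  "saturated_graph V S f = \<lparr>pverts = V,
     parcs = {(u, v). u \<in> V \<and> v \<in> V \<and> u \<noteq> v \<and>
       (u \<in> S \<and> v \<in> S \<longrightarrow> f u div 2 = f v div 2)}\<rparr>"

lemma pair_graph_saturated_graph: "finite V \<Longrightarrow> pair_graph (saturated_graph V S f)"
  by (rule pair_graphI) (auto simp: saturated_graph_def)

lemma dissociation_set_saturated_graph:
  assumes "finite V" "S \<subseteq> V" and f: "inj_on f S"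
  shows "dissociation_set (saturated_graph V S f) S"
proof -
  \<comment> \<open>Exactly two numbers share a given half, so besides \<open>f u\<close> only one
    value is possible in its block.\<close>
  have key: "v = w" if "u \<in> S" "v \<in> S" "w \<in> S" "u \<noteq> v" "u \<noteq> w"
    "f u div 2 = f v div 2" "f u div 2 = f w div 2" for u v w
  proof -
    have "f u \<noteq> f v" "f u \<noteq> f w" using inj_onD[OF f] that by blast+
    then have "f v = f w" using that(6,7) by linarith
    then show ?thesis using inj_onD[OF f] that by blast
  qed
  show ?thesis
    unfolding dissociation_set_iff[OF pair_graph_saturated_graph[OF assms(1)]]
  proof (intro conjI ballI impI)
    show "S \<subseteq> pverts (saturated_graph V S f)" using assms(2) by (simp add: saturated_graph_def)
    fix u v w
    assume "u \<in> S" "v \<in> S" "w \<in> S"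
      "(u, v) \<in> parcs (saturated_graph V S f) \<and> (u, w) \<in> parcs (saturated_graph V S f)"
    then show "v = w" by (intro key[of u v w]) (simp_all add: saturated_graph_def)
  qed
qed

text \<open>Adding arcs can destroy dissociation sets but never creates one.\<close>

lemma dissociation_number_antimono:
  assumes "pair_graph G" "pair_graph H" "pverts G = pverts H" "parcs G \<subseteq> parcs H"
  shows "dissociation_number H \<le> dissociation_number G"
proof -
  obtain S where S: "dissociation_set H S" "card S = dissociation_number H"
    using dissociation_number_attained[OF assms(2)] .
  then have "dissociation_set G S"
    using assms(3,4) unfolding dissociation_set_iff[OF assms(1)] dissociation_set_iff[OF assms(2)]
    by (metis subsetD)
  then show ?thesis using card_le_dissociation_number[OF assms(1)] S(2) by metis
qed

lemma connected_mono:
  assumes "Digraph_Component.connected (with_proj G)"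
    "pverts G = pverts H" "parcs G \<subseteq> parcs H"
  shows "Digraph_Component.connected (with_proj H)"
proof -
  have "(parcs G)\<^sup>s \<subseteq> (parcs H)\<^sup>s" using assms(3) by (auto simp: symcl_def)
  then show ?thesis
    using assms(1,2) rtrancl_on_mono[OF \<open>(parcs G)\<^sup>s \<subseteq> (parcs H)\<^sup>s\<close> order_refl, of _ _ "pverts H"]
    unfolding connected_conv with_proj_simps by simp
qed


section \<open>Isomorphism with the join\<close>

text \<open>An arc is its pair of endpoints, so the vertex bijection dictates the arc map
  \<open>map_prod f f\<close>. The inclusion for \<open>H\<close> rules out arcs with stray
  endpoints, which no arc of \<open>G\<close> could hit.\<close>

lemma digraph_iso_with_projI:
  assumes G: "pair_graph G"
    and f: "bij_betw f (pverts G) (pverts H)"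
    and H: "parcs H \<subseteq> pverts H \<times> pverts H"
    and arcs: "\<And>u v. u \<in> pverts G \<Longrightarrow> v \<in> pverts G \<Longrightarrow>
      (f u, f v) \<in> parcs H \<longleftrightarrow> (u, v) \<in> parcs G"
  shows "digraph_iso (with_proj G) (with_proj H)"
proof -
  let ?hom = "\<lparr>iso_verts = f, iso_arcs = map_prod f f, iso_head = snd, iso_tail = fst\<rparr>"
  interpret pair_graph G by fact
  have sub: "parcs G \<subseteq> pverts G \<times> pverts G" using pair_graph_arcD[OF G] by auto
  have inj: "inj_on f (pverts G)" and im: "f ` pverts G = pverts H"
    using f by (auto simp: bij_betw_def)
  have "inj_on (map_prod f f) (parcs G)"
    using map_prod_inj_on[OF inj inj] sub by (rule inj_on_subset)
  then have "pre_digraph.digraph_isomorphism (with_proj G) ?hom"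
    using inj by (auto simp: pre_digraph.digraph_isomorphism_def wf_digraph_wp_iff)
  moreover have "parcs H = map_prod f f ` parcs G"
  proof
    show "map_prod f f ` parcs G \<subseteq> parcs H" using arcs sub by auto
    show "parcs H \<subseteq> map_prod f f ` parcs G"
    proof
      fix e assume e: "e \<in> parcs H"
      then have "fst e \<in> f ` pverts G" "snd e \<in> f ` pverts G" using H im by auto
      then obtain u v where "u \<in> pverts G" "v \<in> pverts G" "e = (f u, f v)"
        by (metis imageE prod.collapse)
      then show "e \<in> map_prod f f ` parcs G" using e arcs by force
    qed
  qed
  then have "with_proj H = app_iso ?hom (with_proj G)"
    using im by (simp add: app_iso_def with_proj_def)
  ultimately show ?thesis unfolding digraph_iso_def by blast
qed

text \<open>The second factor \<open>B\<close> stays abstract so that both parities share one proof: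
  it need only be numbered by \<open>g\<close> with adjacency meaning equal halves. Vertices outside
  \<open>S\<close> are adjacent to all others, so any numbering \<open>h\<close> of them will
  do.\<close>

lemma saturated_graph_iso_join:
  assumes V: "finite V" and S: "S \<subseteq> V" and f: "bij_betw f S {..<card S}"
    and g: "bij_betw g {..<card S} (pverts B)"
    and B: "parcs B \<subseteq> pverts B \<times> pverts B"
    and arcs: "\<And>i j. i < card S \<Longrightarrow> j < card S \<Longrightarrow>
      (g i, g j) \<in> parcs B \<longleftrightarrow> i \<noteq> j \<and> i div 2 = j div 2"
  shows "digraph_iso (with_proj (saturated_graph V S f))
    (with_proj (graph_join (complete_graph (card V - card S)) B))"
proof -
  let ?m = "card V - card S"
  let ?H = "graph_join (complete_graph ?m) B"
  have "card (V - S) = ?m" using V S by (simp add: card_Diff_subset finite_subset)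
  then obtain h where h: "bij_betw h (V - S) {..<?m}"
    using ex_bij_betw_finite_nat[of "V - S"] V by (auto simp: atLeast0LessThan)
  define k where "k u = (if u \<in> S then Inr (g (f u)) else Inl (h u))" for u
  have gf: "bij_betw (\<lambda>u. g (f u)) S (pverts B)"
    using bij_betw_trans[OF f g] by (simp add: comp_def)
  have fS: "f u < card S" if "u \<in> S" for u using bij_betwE[OF f] that by blast
  have f_eq: "f u = f v \<longleftrightarrow> u = v" if "u \<in> S" "v \<in> S" for u v
    using bij_betw_imp_inj_on[OF f] that by (auto dest: inj_onD)
  have h_eq: "h u = h v \<longleftrightarrow> u = v" if "u \<in> V - S" "v \<in> V - S" for u v
    using bij_betw_imp_inj_on[OF h] that by (auto dest: inj_onD)
  have hV: "h u < ?m" if "u \<in> V" "u \<notin> S" for u using bij_betwE[OF h] that by blast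
  have gfB: "g (f u) \<in> pverts B" if "u \<in> S" for u using bij_betwE[OF gf] that by blast
  have "bij_betw k (S \<union> (V - S)) (Inr ` pverts B \<union> Inl ` {..<?m})"
  proof (rule bij_betw_combine)
    have "bij_betw (\<lambda>u. Inr (g (f u))) S (Inr ` pverts B)"
      using bij_betw_trans[OF gf inj_on_imp_bij_betw[of Inr "pverts B"]] by (simp add: comp_def)
    then show "bij_betw k S (Inr ` pverts B)" by (rule bij_betw_cong[THEN iffD1, rotated]) (simp add: k_def)
    have "bij_betw (\<lambda>u. Inl (h u)) (V - S) (Inl ` {..<?m})"
      using bij_betw_trans[OF h inj_on_imp_bij_betw[of Inl "{..<?m}"]] by (simp add: comp_def)
    then show "bij_betw k (V - S) (Inl ` {..<?m})" by (rule bij_betw_cong[THEN iffD1, rotated]) (simp add: k_def)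
  qed auto
  moreover have "S \<union> (V - S) = V" using S by blast
  moreover have "Inr ` pverts B \<union> Inl ` {..<?m} = pverts ?H"
    by (auto simp: graph_join_def disjoint_union_def complete_graph_def)
  ultimately have bij: "bij_betw k V (pverts ?H)" by simp
  show ?thesis
  proof (rule digraph_iso_with_projI)
    show "pair_graph (saturated_graph V S f)" by (rule pair_graph_saturated_graph[OF V])
    show "bij_betw k (pverts (saturated_graph V S f)) (pverts ?H)"
      using bij by (simp add: saturated_graph_def)
    show "parcs ?H \<subseteq> pverts ?H \<times> pverts ?H"
      using B by (auto simp: graph_join_def disjoint_union_def complete_graph_def)
    show "(k u, k v) \<in> parcs ?H \<longleftrightarrow> (u, v) \<in> parcs (saturated_graph V S f)"
      if "u \<in> pverts (saturated_graph V S f)" "v \<in> pverts (saturated_graph V S f)" for u v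
    proof -
      have uv: "u \<in> V" "v \<in> V" using that by (auto simp: saturated_graph_def)
      note defs = saturated_graph_def graph_join_def disjoint_union_def complete_graph_def
      consider "u \<in> S" "v \<in> S" | "u \<in> S" "v \<notin> S" | "u \<notin> S" "v \<in> S" | "u \<notin> S" "v \<notin> S" by blast
      then show ?thesis
      proof cases
        case 1
        then show ?thesis using uv arcs[OF fS fS] f_eq by (simp add: k_def defs)
      next
        case 2
        then show ?thesis using uv gfB hV by (auto simp: k_def defs)
      next
        case 3
        then show ?thesis using uv gfB hV by (auto simp: k_def defs)
      next
        case 4
        then show ?thesis using uv hV h_eq by (auto simp: k_def defs)
      qed
    qed
  qed
qed

text \<open>The number \<open>i\<close> stands for vertex \<open>i mod 2\<close> of copy
  \<open>i div 2\<close>. The bound on \<open>i\<close> also controls \<open>j\<close>, since equal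
  halves put both in the same copy.\<close>

lemma copies_complete_graph_2_arc_iff:
  assumes "i < 2 * m"
  shows "((i div 2, i mod 2), (j div 2, j mod 2)) \<in> parcs (copies m (complete_graph 2)) \<longleftrightarrow>
    i \<noteq> j \<and> i div 2 = j div 2"
proof -
  have "i div 2 < m" using assms by linarith
  moreover have "i mod 2 \<noteq> j mod 2 \<longleftrightarrow> i \<noteq> j" if "i div 2 = j div 2"
    using that by (metis div_mult_mod_eq)
  ultimately show ?thesis by (auto simp: copies_def complete_graph_def)
qed

lemma copies_subset_Times:
  "parcs G \<subseteq> pverts G \<times> pverts G \<Longrightarrow> parcs (copies m G) \<subseteq> pverts (copies m G) \<times> pverts (copies m G)"
  by (auto simp: copies_def)

lemma complete_graph_subset_Times:
  "parcs (complete_graph m) \<subseteq> pverts (complete_graph m) \<times> pverts (complete_graph m)"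
  by (auto simp: complete_graph_def)

section \<open>Identification of the extremal graph\<close>

theorem theorem1p1:
  fixes G :: "'a pair_pre_digraph" and n \<tau> :: nat and \<alpha> :: real
  assumes "n \<ge> 1" and "0 \<le> \<alpha>" and "\<alpha> < 1"
    and "G \<in> connected_graphs n \<tau>"
    and "\<And>H :: 'a pair_pre_digraph. H \<in> connected_graphs n \<tau> \<Longrightarrow>
      A_alpha_index \<alpha> H \<le> A_alpha_index \<alpha> G"
  shows "(even \<tau> \<longrightarrow>
      digraph_iso (with_proj G)
        (with_proj (graph_join (complete_graph (n - \<tau>))
          (copies (\<tau> div 2) (complete_graph 2))))) \<and>
    (odd \<tau> \<longrightarrow>
      digraph_iso (with_proj G)
        (with_proj (graph_join (complete_graph (n - \<tau>))
          (disjoint_union (copies ((\<tau> - 1) div 2) (complete_graph 2)) (complete_graph 1)))))"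
proof -
  have G: "pair_graph G" and conn: "Digraph_Component.connected (with_proj G)"
    and n: "card (pverts G) = n" and \<tau>: "dissociation_number G = \<tau>"
    using assms(4) by (auto simp: connected_graphs_def)
  note fin = pair_graph_finite(1)[OF G]
  obtain S where S: "dissociation_set G S" "card S = \<tau>"
    using dissociation_number_attained[OF G] \<tau> by metis
  then have SV: "S \<subseteq> pverts G"
    and S1: "\<And>u v w. u \<in> S \<Longrightarrow> v \<in> S \<Longrightarrow> w \<in> S \<Longrightarrow> (u, v) \<in> parcs G \<Longrightarrow> (u, w) \<in> parcs G \<Longrightarrow> v = w"
    unfolding dissociation_set_iff[OF G] by blast+
  have finS: "finite S" using SV fin by (rule finite_subset)
  obtain f :: "'a \<Rightarrow> nat" where f: "bij_betw f S {..<card S}"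
    and fdiv: "\<And>u v. u \<in> S \<Longrightarrow> v \<in> S \<Longrightarrow> (u, v) \<in> parcs G \<Longrightarrow> f u div 2 = f v div 2"
  proof -
    have "\<exists>f::'a \<Rightarrow> nat. bij_betw f S {..<card S} \<and>
        (\<forall>u\<in>S. \<forall>v\<in>S. (u, v) \<in> parcs G \<longrightarrow> f u div 2 = f v div 2)"
      by (rule matching_enumeration[OF finS]) (use S1 pair_graph_arcD(3,4)[OF G] in blast)+
    then show ?thesis using that by blast
  qed
  define H where "H = saturated_graph (pverts G) S f"
  have H: "pair_graph H" unfolding H_def by (rule pair_graph_saturated_graph[OF fin])
  have VH: "pverts G = pverts H" by (simp add: H_def saturated_graph_def)
  have sub: "parcs G \<subseteq> parcs H"
    using pair_graph_arcD(1,2)[OF G] fdiv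
    by (auto simp: H_def saturated_graph_def dest: pair_graph_arcD(3)[OF G])
  have "dissociation_number H = \<tau>"
  proof (rule antisym)
    show "dissociation_number H \<le> \<tau>"
      using dissociation_number_antimono[OF G H VH sub] \<tau> by simp
    have "dissociation_set H S"
      unfolding H_def using fin SV bij_betw_imp_inj_on[OF f] by (rule dissociation_set_saturated_graph)
    then show "\<tau> \<le> dissociation_number H"
      using card_le_dissociation_number[OF H] S(2) by metis
  qed
  then have "H \<in> connected_graphs n \<tau>"
    using H VH n connected_mono[OF conn VH sub] by (simp add: connected_graphs_def)
  then have "A_alpha_index \<alpha> H \<le> A_alpha_index \<alpha> G" by (rule assms(5))
  \<comment> \<open>\<open>H\<close> competes with \<open>G\<close>, and a proper inclusion of arcs
    would give it a strictly larger index.\<close>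
  then have "parcs G = parcs H"
    using A_alpha_index_strict_mono[OF assms(2,3) G H conn VH] sub by fastforce
  with VH have GH: "G = saturated_graph (pverts G) S f" by (simp add: H_def)
  \<comment> \<open>Stated for an arbitrary vertex type of \<open>B\<close>, because the even and
    the odd case use graphs over different types.\<close>
  have iso: "digraph_iso (with_proj G) (with_proj (graph_join (complete_graph (n - \<tau>)) B))"
    if "bij_betw g {..<\<tau>} (pverts B)" "parcs B \<subseteq> pverts B \<times> pverts B"
      "\<And>i j. i < \<tau> \<Longrightarrow> j < \<tau> \<Longrightarrow> (g i, g j) \<in> parcs B \<longleftrightarrow> i \<noteq> j \<and> i div 2 = j div 2"
    for g and B :: "'b pair_pre_digraph"
    using saturated_graph_iso_join[OF fin SV f, of g B] that unfolding GH[symmetric] n S(2) by blast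
  show ?thesis
  proof (intro conjI impI)
    assume "even \<tau>"
    then obtain m where m: "\<tau> = 2 * m" by blast
    let ?B = "copies (\<tau> div 2) (complete_graph 2)"
    show "digraph_iso (with_proj G) (with_proj (graph_join (complete_graph (n - \<tau>)) ?B))"
    proof (rule iso)
      show "bij_betw (\<lambda>i. (i div 2, i mod 2)) {..<\<tau>} (pverts ?B)"
        by (rule bij_betw_byWitness[where f' = "\<lambda>(a, b). 2 * a + b"])
          (auto simp: m copies_def complete_graph_def)
      show "parcs ?B \<subseteq> pverts ?B \<times> pverts ?B"
        by (intro copies_subset_Times complete_graph_subset_Times)
      show "((i div 2, i mod 2), (j div 2, j mod 2)) \<in> parcs ?B \<longleftrightarrow> i \<noteq> j \<and> i div 2 = j div 2"
        if "i < \<tau>" "j < \<tau>" for i j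
        using that m by (intro copies_complete_graph_2_arc_iff) simp
    qed
  next
    assume "odd \<tau>"
    then obtain m where m: "\<tau> = 2 * m + 1" by (rule oddE)
    let ?C = "copies ((\<tau> - 1) div 2) (complete_graph 2)"
    let ?B = "disjoint_union ?C (complete_graph 1)"
    \<comment> \<open>The last number \<open>2 * m\<close> would be paired with
      \<open>2 * m + 1\<close>, which is out of range; it becomes the isolated vertex.\<close>
    let ?g = "\<lambda>i. if i < 2 * m then Inl (i div 2, i mod 2) else Inr 0"
    show "digraph_iso (with_proj G) (with_proj (graph_join (complete_graph (n - \<tau>)) ?B))"
    proof (rule iso)
      show "bij_betw ?g {..<\<tau>} (pverts ?B)"
        by (rule bij_betw_byWitness[where f' = "case_sum (\<lambda>(a, b). 2 * a + b) (\<lambda>_. 2 * m)"])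
          (auto simp: m copies_def complete_graph_def disjoint_union_def)
      have "parcs ?C \<subseteq> pverts ?C \<times> pverts ?C"
        by (intro copies_subset_Times complete_graph_subset_Times)
      then show "parcs ?B \<subseteq> pverts ?B \<times> pverts ?B"
        using complete_graph_subset_Times[of 1] by (auto simp: disjoint_union_def)
      show "(?g i, ?g j) \<in> parcs ?B \<longleftrightarrow> i \<noteq> j \<and> i div 2 = j div 2"
        if "i < \<tau>" "j < \<tau>" for i j
      proof (cases "i < 2 * m \<and> j < 2 * m")
        case True
        then have "(?g i, ?g j) \<in> parcs ?B \<longleftrightarrow> ((i div 2, i mod 2), (j div 2, j mod 2)) \<in> parcs ?C"
          by (simp add: disjoint_union_def)
        then show ?thesis using True m by (simp add: copies_complete_graph_2_arc_iff)
      next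
        case False
        then have "(?g i, ?g j) \<notin> parcs ?B"
          by (auto simp: disjoint_union_def complete_graph_def)
        \<comment> \<open>One of the numbers is \<open>2 * m\<close>, the only one below \<tau> with
          half \<open>m\<close>.\<close>
        moreover have "\<not> (i \<noteq> j \<and> i div 2 = j div 2)" using False that m by presburger
        ultimately show ?thesis by blast
      qed
    qed
  qed
qed

end
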